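(* Let $0\to\mathfrak{h}_S\xrightarrow{i}\mathfrak{e}_U\xrightarrow{p}\mathfrak{g}_T\to0$ be a non-abelian extension of Rota-Baxter Lie algebras. Then there is an exact sequence $$1\to\mathrm{Aut}_\mathfrak{h}^{\mathfrak{h},\mathfrak{g}}(\mathfrak{e}_U)\xrightarrow{\iota}\mathrm{Aut}_\mathfrak{h}(\mathfrak{e}_U)\xrightarrow{\tau}\mathrm{Aut}(\mathfrak{h}_S)\times\mathrm{Aut}(\mathfrak{g}_T)\xrightarrow{\mathcal{W}}H^2_{nab}(\mathfrak{g}_T,\mathfrak{h}_S).$$ Here $\mathrm{Aut}_\mathfrak{h}^{\mathfrak{h},\mathfrak{g}}(\mathfrak{e}_U)=\{\gamma\in\mathrm{Aut}(\mathfrak{e}_U)\mid\tau(\gamma)=(\mathrm{id}_\mathfrak{h},\mathrm{id}_\mathfrak{g})\}$, $\iota$ is the inclusion map and $\mathcal{W}$ is the Wells map.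
   Context: All vector spaces, linear maps and Lie algebras are over a field $\mathbf{k}$ of characteristic $0$. A Rota-Baxter Lie algebra $\mathfrak{g}_T$ is a Lie algebra $\mathfrak{g}$ with a linear map $T:\mathfrak{g}\to\mathfrak{g}$ satisfying $[T(x),T(y)]_\mathfrak{g}=T([T(x),y]_\mathfrak{g}+[x,T(y)]_\mathfrak{g})$ for all $x,y\in\mathfrak{g}$. A morphism $\mathfrak{g}_T\to\mathfrak{g}'_{T'}$ is a Lie algebra homomorphism $\varphi$ with $T'\circ\varphi=\varphi\circ T$; $\mathrm{Aut}(\mathfrak{g}_T)$ is the group of bijective morphisms $\mathfrak{g}_T\to\mathfrak{g}_T$. A non-abelian extension of $\mathfrak{g}_T$ by $\mathfrak{h}_S$ is a Rota-Baxter Lie algebra $\mathfrak{e}_U$ with a short exact sequence $0\to\mathfrak{h}_S\xrightarrow{i}\mathfrak{e}_U\xrightarrow{p}\mathfrak{g}_T\to0$ of Rota-Baxter Lie algebras; $\mathfrak{h}$ is identified with $i(\mathfrak{h})\subset\mathfrak{e}$. A section of $p$ is a linear map $s:\mathfrak{g}\to\mathfrak{e}$ with $p\circ s=\mathrm{id}_\mathfrak{g}$. $\mathrm{Aut}_\mathfrak{h}(\mathfrak{e}_U)$ is the set of $\gamma\in\mathrm{Aut}(\mathfrak{e}_U)$ with $\gamma|_\mathfrak{h}\subset\mathfrak{h}$ (that is, $\gamma(\mathfrak{h})\subset\mathfrak{h}$), and $\tau:\mathrm{Aut}_\mathfrak{h}(\mathfrak{e}_U)\to\mathrm{Aut}(\mathfrak{h}_S)\times\mathrm{Aut}(\mathfrak{g}_T)$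 is the group homomorphism $\tau(\gamma)=(\gamma|_\mathfrak{h},\overline\gamma)$, where $\overline\gamma=p\gamma s$ is independent of the section $s$. A non-abelian $2$-cocycle of $\mathfrak{g}_T$ with values in $\mathfrak{h}_S$ is a triple $(\chi,\psi,\Phi)$ of linear maps $\chi:\wedge^2\mathfrak{g}\to\mathfrak{h}$, $\psi:\mathfrak{g}\to\mathrm{Der}(\mathfrak{h})$ (Lie derivations), $\Phi:\mathfrak{g}\to\mathfrak{h}$ such that for all $x,y,z\in\mathfrak{g}$, $h\in\mathfrak{h}$: (i) $\psi_x\psi_y(h)-\psi_y\psi_x(h)-\psi_{[x,y]_\mathfrak{g}}(h)=[\chi(x,y),h]_\mathfrak{h}$; (ii) $\psi_x\chi(y,z)+\psi_y\chi(z,x)+\psi_z\chi(x,y)-\chi([x,y]_\mathfrak{g},z)-\chi([y,z]_\mathfrak{g},x)-\chi([z,x]_\mathfrak{g},y)=0$; (iii) $\psi_{T(x)}S(h)=S(\psi_xS(h)+\psi_{T(x)}h)+S[\Phi(x),h]_\mathfrak{h}-[\Phi(x),S(h)]_\mathfrak{h}$; (iv) $\chi(T(x),T(y))-S(\chi(x,T(y))+\chi(T(x),y))-\Phi([x,T(y)]_\mathfrak{g}+[T(x),y]_\mathfrak{g})+\psi_{T(x)}\Phi(y)-\psi_{T(y)}\Phi(x)-S(\psi_x\Phi(y)-\psi_y\Phi(x))+[\Phi(x),\Phi(y)]_\mathfrak{h}=0$. Two such cocycles $(\chi,\psi,\Phi)$, $(\chi',\psi',\Phi')$ are equivalent if there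 is a linear map $\varphi:\mathfrak{g}\to\mathfrak{h}$ with $\psi_x(h)-\psi'_x(h)=[\varphi(x),h]_\mathfrak{h}$, $\chi(x,y)-\chi'(x,y)=\psi'_x(\varphi(y))-\psi'_y(\varphi(x))-\varphi([x,y]_\mathfrak{g})+[\varphi(x),\varphi(y)]_\mathfrak{h}$, $\Phi(x)-\Phi'(x)=S(\varphi(x))-\varphi(T(x))$ for all $x,y\in\mathfrak{g}$, $h\in\mathfrak{h}$. $H^2_{nab}(\mathfrak{g}_T,\mathfrak{h}_S)$ is the set of equivalence classes. Fix a section $s$; the non-abelian $2$-cocycle induced by $s$ is $\chi(x,y)=[s(x),s(y)]_\mathfrak{e}-s[x,y]_\mathfrak{g}$, $\psi_x(h)=[s(x),h]_\mathfrak{e}$, $\Phi(x)=U(s(x))-s(T(x))$. For $(\beta,\alpha)\in\mathrm{Aut}(\mathfrak{h}_S)\times\mathrm{Aut}(\mathfrak{g}_T)$ put $\chi_{(\beta,\alpha)}(x,y)=\beta\chi(\alpha^{-1}(x),\alpha^{-1}(y))$, $(\psi_{(\beta,\alpha)})_xh=\beta(\psi_{\alpha^{-1}(x)}\beta^{-1}(h))$, $\Phi_{(\beta,\alpha)}(x)=\beta\Phi(\alpha^{-1}(x))$, again a non-abelian $2$-cocycle. The Wells map is the set map $\mathcal{W}:\mathrm{Aut}(\mathfrak{h}_S)\times\mathrm{Aut}(\mathfrak{g}_T)\to H^2_{nab}(\mathfrak{g}_T,\mathfrak{h}_S)$ given by $\mathcal{W}((\beta,\alpha))=[(\chi_{(\beta,\alpha)},\psi_{(\beta,\alpha)},\Phi_{(\beta,\alpha)})-(\chi,\psi,\Phi)]$,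 the equivalence class of the difference (it may not be a group homomorphism). $\ker(\mathcal{W})$ is the set of $(\beta,\alpha)$ with $\mathcal{W}((\beta,\alpha))=0$, this vanishing being used to mean that $(\chi_{(\beta,\alpha)},\psi_{(\beta,\alpha)},\Phi_{(\beta,\alpha)})$ and $(\chi,\psi,\Phi)$ are equivalent.
   Formalization: Aut_h(e_U) is taken with γ(h) = h rather than γ(h) ⊂ h, since otherwise τ need not land in automorphisms (infinite dimension); the Wells map is the class of the twisted cocycle, with zero the class of the induced cocycle, as a difference of cocycles need not be a cocycle. *)

theory Defs
  imports Complex_Main "HOL-Algebra.Coset"
begin

text \<open>
  The underlying vector space of an algebra is an entire type of class \<open>ab_group_add\<close>; the
  scalar multiplication over the field \<open>'k\<close> is part of the structure.
\<close>

record ('k, 'a) lie =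
  scl :: "'k \<Rightarrow> 'a \<Rightarrow> 'a"
  br :: "'a \<Rightarrow> 'a \<Rightarrow> 'a"

record ('k, 'a) rb_lie = "('k, 'a) lie" +
  rb :: "'a \<Rightarrow> 'a"

abbreviation klinear ::
    "('k::field_char_0, 'a::ab_group_add, 'x) lie_scheme \<Rightarrow>
     ('k, 'b::ab_group_add, 'y) lie_scheme \<Rightarrow> ('a \<Rightarrow> 'b) \<Rightarrow> bool"
  where "klinear L M \<equiv> Vector_Spaces.linear (scl L) (scl M)"

locale lie_algebra = vector_space "scl L"
  for L :: "('k::field_char_0, 'a::ab_group_add, 'x) lie_scheme" +
  assumes br_linear_left: "klinear L L (\<lambda>x. br L x y)"
    and br_linear_right: "klinear L L (br L x)"
    and br_self: "br L x x = 0"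
    and jacobi: "br L x (br L y z) + br L y (br L z x) + br L z (br L x y) = 0"

locale rota_baxter_lie_algebra = lie_algebra L
  for L :: "('k::field_char_0, 'a::ab_group_add, 'x) rb_lie_scheme" +
  assumes rb_linear: "klinear L L (rb L)"
    and rota_baxter: "br L (rb L x) (rb L y) = rb L (br L (rb L x) y + br L x (rb L y))"

definition rb_hom ::
    "('k::field_char_0, 'a::ab_group_add, 'x) rb_lie_scheme \<Rightarrow>
     ('k, 'b::ab_group_add, 'y) rb_lie_scheme \<Rightarrow> ('a \<Rightarrow> 'b) \<Rightarrow> bool"
  where "rb_hom L M f \<longleftrightarrow> klinear L M f \<and> (\<forall>x y. f (br L x y) = br M (f x) (f y)) \<and>
    rb M \<circ> f = f \<circ> rb L"

definition comp_group :: "('a \<Rightarrow> 'a) set \<Rightarrow> ('a \<Rightarrow> 'a) monoid"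
  where "comp_group A = \<lparr>carrier = A, monoid.mult = (\<circ>), one = id\<rparr>"

definition rb_auts ::
    "('k::field_char_0, 'a::ab_group_add, 'x) rb_lie_scheme \<Rightarrow> ('a \<Rightarrow> 'a) set"
  where "rb_auts L = {f. rb_hom L L f \<and> bij f}"

definition Aut ::
    "('k::field_char_0, 'a::ab_group_add, 'x) rb_lie_scheme \<Rightarrow> ('a \<Rightarrow> 'a) monoid"
  where "Aut L = comp_group (rb_auts L)"


section \<open>Non-abelian extensions and their automorphisms\<close>

locale rb_extension =
  H: rota_baxter_lie_algebra H + E: rota_baxter_lie_algebra E + G: rota_baxter_lie_algebra G
  for H :: "('k::field_char_0, 'h::ab_group_add) rb_lie"
    and E :: "('k, 'e::ab_group_add) rb_lie"
    and G :: "('k, 'g::ab_group_add) rb_lie"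
    and i :: "'h \<Rightarrow> 'e" and p :: "'e \<Rightarrow> 'g" +
  assumes i_hom: "rb_hom H E i"
    and p_hom: "rb_hom E G p"
    and i_inj: "inj i"
    and p_surj: "surj p"
    and exact: "range i = {e. p e = 0}"

definition is_section ::
    "('k::field_char_0, 'e::ab_group_add) rb_lie \<Rightarrow> ('k, 'g::ab_group_add) rb_lie \<Rightarrow>
     ('e \<Rightarrow> 'g) \<Rightarrow> ('g \<Rightarrow> 'e) \<Rightarrow> bool"
  where "is_section E G p s \<longleftrightarrow> klinear G E s \<and> p \<circ> s = id"

text \<open>
  The automorphisms of \<open>E\<close> preserving \<open>i(H)\<close>. The condition is equality, not just
  inclusion \<open>\<gamma>(H) \<subseteq> H\<close>. These agree if \<open>H\<close> is finite-dimensional, but in general the inclusion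
  does not make the restriction of \<open>\<gamma>\<close> an automorphism: take a vector space with basis \<open>(e\<^sub>n)\<close>
  indexed by the integers, with zero bracket and zero operator, \<open>H\<close> spanned by the \<open>e\<^sub>n\<close> with
  \<open>n \<ge> 0\<close>, and the shift \<open>e\<^sub>n \<mapsto> e\<^sub>n\<^sub>+\<^sub>1\<close>. Equality singles out precisely those \<open>\<gamma>\<close>, among
  the ones with \<open>\<gamma>(H) \<subseteq> H\<close>, whose restriction and quotient map are automorphisms, that is, for
  which \<open>\<tau>(\<gamma>)\<close> below lies in \<open>Aut H \<times> Aut G\<close>; see the lemmas \<open>Aut_h_iff_tau\<close> and
  \<open>Aut_h_iff_subset\<close>.
\<close>

definition Aut_h ::
    "('k::field_char_0, 'e::ab_group_add) rb_lie \<Rightarrow> ('h \<Rightarrow> 'e) \<Rightarrow> ('e \<Rightarrow> 'e) monoid"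
  where "Aut_h E i = comp_group {\<gamma> \<in> rb_auts E. \<gamma> ` range i = range i}"

text \<open>
  \<open>inv_into UNIV i\<close> is the identification of \<open>i(H)\<close> with \<open>H\<close>, so the first component is the
  restriction of \<open>\<gamma>\<close> to \<open>H\<close>. It is meaningful only if \<open>\<gamma>\<close> preserves \<open>i(H)\<close>.
\<close>

definition tau ::
    "('h \<Rightarrow> 'e) \<Rightarrow> ('e \<Rightarrow> 'g) \<Rightarrow> ('g \<Rightarrow> 'e) \<Rightarrow> ('e \<Rightarrow> 'e) \<Rightarrow> ('h \<Rightarrow> 'h) \<times> ('g \<Rightarrow> 'g)"
  where "tau i p s \<gamma> = (inv_into UNIV i \<circ> \<gamma> \<circ> i, p \<circ> \<gamma> \<circ> s)"

definition Aut_hg ::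
    "('k::field_char_0, 'e::ab_group_add) rb_lie \<Rightarrow> ('h \<Rightarrow> 'e) \<Rightarrow> ('e \<Rightarrow> 'g) \<Rightarrow> ('g \<Rightarrow> 'e) \<Rightarrow>
     ('e \<Rightarrow> 'e) monoid"
  where "Aut_hg E i p s = comp_group {\<gamma> \<in> carrier (Aut_h E i). tau i p s \<gamma> = (id, id)}"


section \<open>Non-abelian cohomology\<close>

type_synonym ('g, 'h) cochain = "('g \<Rightarrow> 'g \<Rightarrow> 'h) \<times> ('g \<Rightarrow> 'h \<Rightarrow> 'h) \<times> ('g \<Rightarrow> 'h)"

definition derivation ::
    "('k::field_char_0, 'a::ab_group_add, 'x) lie_scheme \<Rightarrow> ('a \<Rightarrow> 'a) \<Rightarrow> bool"
  where "derivation L d \<longleftrightarrow> klinear L L d \<and> (\<forall>x y. d (br L x y) = br L (d x) y + br L x (d y))"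

text \<open>Linear maps on the exterior square are alternating bilinear maps.\<close>

definition nab_cocycles ::
    "('k::field_char_0, 'g::ab_group_add) rb_lie \<Rightarrow> ('k, 'h::ab_group_add) rb_lie \<Rightarrow>
     ('g, 'h) cochain set"
  where "nab_cocycles G H = {(\<chi>, \<psi>, \<Phi>).
    (\<forall>x. klinear G H (\<chi> x)) \<and> (\<forall>y. klinear G H (\<lambda>x. \<chi> x y)) \<and> (\<forall>x. \<chi> x x = 0) \<and>
    (\<forall>x. derivation H (\<psi> x)) \<and> (\<forall>h. klinear G H (\<lambda>x. \<psi> x h)) \<and>
    klinear G H \<Phi> \<and>
    (\<forall>x y h. \<psi> x (\<psi> y h) - \<psi> y (\<psi> x h) - \<psi> (br G x y) h = br H (\<chi> x y) h) \<and>
    (\<forall>x y z. \<psi> x (\<chi> y z) + \<psi> y (\<chi> z x) + \<psi> z (\<chi> x y)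
       - \<chi> (br G x y) z - \<chi> (br G y z) x - \<chi> (br G z x) y = 0) \<and>
    (\<forall>x h. \<psi> (rb G x) (rb H h) =
       rb H (\<psi> x (rb H h) + \<psi> (rb G x) h) + rb H (br H (\<Phi> x) h) - br H (\<Phi> x) (rb H h)) \<and>
    (\<forall>x y. \<chi> (rb G x) (rb G y) - rb H (\<chi> x (rb G y) + \<chi> (rb G x) y)
       - \<Phi> (br G x (rb G y) + br G (rb G x) y)
       + \<psi> (rb G x) (\<Phi> y) - \<psi> (rb G y) (\<Phi> x)
       - rb H (\<psi> x (\<Phi> y) - \<psi> y (\<Phi> x)) + br H (\<Phi> x) (\<Phi> y) = 0)}"

definition nab_equivalent ::
    "('k::field_char_0, 'g::ab_group_add) rb_lie \<Rightarrow> ('k, 'h::ab_group_add) rb_lie \<Rightarrow>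
     ('g, 'h) cochain \<Rightarrow> ('g, 'h) cochain \<Rightarrow> bool"
  where "nab_equivalent G H = (\<lambda>(\<chi>, \<psi>, \<Phi>) (\<chi>', \<psi>', \<Phi>').
    \<exists>\<phi>. klinear G H \<phi> \<and>
      (\<forall>x h. \<psi> x h - \<psi>' x h = br H (\<phi> x) h) \<and>
      (\<forall>x y. \<chi> x y - \<chi>' x y =
         \<psi>' x (\<phi> y) - \<psi>' y (\<phi> x) - \<phi> (br G x y) + br H (\<phi> x) (\<phi> y)) \<and>
      (\<forall>x. \<Phi> x - \<Phi>' x = rb H (\<phi> x) - \<phi> (rb G x)))"

definition nab_rel ::
    "('k::field_char_0, 'g::ab_group_add) rb_lie \<Rightarrow> ('k, 'h::ab_group_add) rb_lie \<Rightarrow>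
     (('g, 'h) cochain \<times> ('g, 'h) cochain) set"
  where "nab_rel G H = {(c, c'). c \<in> nab_cocycles G H \<and> c' \<in> nab_cocycles G H \<and>
    nab_equivalent G H c c'}"

definition H2_nab ::
    "('k::field_char_0, 'g::ab_group_add) rb_lie \<Rightarrow> ('k, 'h::ab_group_add) rb_lie \<Rightarrow>
     ('g, 'h) cochain set set"
  where "H2_nab G H = nab_cocycles G H // nab_rel G H"

definition nab_class ::
    "('k::field_char_0, 'g::ab_group_add) rb_lie \<Rightarrow> ('k, 'h::ab_group_add) rb_lie \<Rightarrow>
     ('g, 'h) cochain \<Rightarrow> ('g, 'h) cochain set"
  where "nab_class G H c = nab_rel G H `` {c}"


section \<open>The Wells map\<close>

definition induced_cocycle ::
    "('k::field_char_0, 'e::ab_group_add) rb_lie \<Rightarrow> ('k, 'g::ab_group_add) rb_lie \<Rightarrow>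
     ('h \<Rightarrow> 'e) \<Rightarrow> ('g \<Rightarrow> 'e) \<Rightarrow> ('g, 'h) cochain"
  where "induced_cocycle E G i s =
    (\<lambda>x y. inv_into UNIV i (br E (s x) (s y) - s (br G x y)),
     \<lambda>x h. inv_into UNIV i (br E (s x) (i h)),
     \<lambda>x. inv_into UNIV i (rb E (s x) - s (rb G x)))"

definition twist :: "('h \<Rightarrow> 'h) \<times> ('g \<Rightarrow> 'g) \<Rightarrow> ('g, 'h) cochain \<Rightarrow> ('g, 'h) cochain"
  where "twist = (\<lambda>(\<beta>, \<alpha>) (\<chi>, \<psi>, \<Phi>).
    (\<lambda>x y. \<beta> (\<chi> (inv_into UNIV \<alpha> x) (inv_into UNIV \<alpha> y)),
     \<lambda>x h. \<beta> (\<psi> (inv_into UNIV \<alpha> x) (inv_into UNIV \<beta> h)),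
     \<lambda>x. \<beta> (\<Phi> (inv_into UNIV \<alpha> x))))"

text \<open>
  A difference of two non-abelian cocycles is in general not a cocycle, so the class of
  \<open>twist (\<beta>, \<alpha>) c - c\<close> is read as the class of \<open>twist (\<beta>, \<alpha>) c\<close> in the set
  \<open>H2_nab G H\<close> pointed by the class of the induced cocycle \<open>c\<close>. The Wells map vanishes where it
  takes the value \<open>Wells_zero\<close>, that is, where \<open>twist (\<beta>, \<alpha>) c\<close> and \<open>c\<close> are equivalent
  (lemma \<open>nab_class_eq_iff\<close>).
\<close>

definition Wells ::
    "('k::field_char_0, 'h::ab_group_add) rb_lie \<Rightarrow> ('k, 'e::ab_group_add) rb_lie \<Rightarrow>
     ('k, 'g::ab_group_add) rb_lie \<Rightarrow> ('h \<Rightarrow> 'e) \<Rightarrow> ('g \<Rightarrow> 'e) \<Rightarrow>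
     ('h \<Rightarrow> 'h) \<times> ('g \<Rightarrow> 'g) \<Rightarrow> ('g, 'h) cochain set"
  where "Wells H E G i s ba = nab_class G H (twist ba (induced_cocycle E G i s))"

definition Wells_zero ::
    "('k::field_char_0, 'h::ab_group_add) rb_lie \<Rightarrow> ('k, 'e::ab_group_add) rb_lie \<Rightarrow>
     ('k, 'g::ab_group_add) rb_lie \<Rightarrow> ('h \<Rightarrow> 'e) \<Rightarrow> ('g \<Rightarrow> 'e) \<Rightarrow> ('g, 'h) cochain set"
  where "Wells_zero H E G i s = nab_class G H (induced_cocycle E G i s)"

definition Wells_kernel ::
    "('k::field_char_0, 'h::ab_group_add) rb_lie \<Rightarrow> ('k, 'e::ab_group_add) rb_lie \<Rightarrow>
     ('k, 'g::ab_group_add) rb_lie \<Rightarrow> ('h \<Rightarrow> 'e) \<Rightarrow> ('g \<Rightarrow> 'e) \<Rightarrow>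
     (('h \<Rightarrow> 'h) \<times> ('g \<Rightarrow> 'g)) set"
  where "Wells_kernel H E G i s =
    {ba \<in> carrier (Aut H \<times>\<times> Aut G). Wells H E G i s ba = Wells_zero H E G i s}"


section \<open>Consistency of the definitions\<close>

lemma klinear_simps:
  assumes "klinear L M f"
  shows "f (x + y) = f x + f y" "f (x - y) = f x - f y" "f (- x) = - f x" "f 0 = 0"
    "f (scl L a x) = scl M a (f x)"
proof -
  interpret Vector_Spaces.linear "scl L" "scl M" f by fact
  show "f (x + y) = f x + f y" "f (x - y) = f x - f y" "f (- x) = - f x" "f 0 = 0"
    "f (scl L a x) = scl M a (f x)"
    by (simp_all add: add diff neg zero scale)
qed

lemma nab_rel_equiv:
  fixes G :: "('k::field_char_0, 'g::ab_group_add) rb_lie"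
    and H :: "('k, 'h::ab_group_add) rb_lie"
  assumes G: "rota_baxter_lie_algebra G" and H: "rota_baxter_lie_algebra H"
  shows "equiv (nab_cocycles G H) (nab_rel G H)"
proof -
  interpret G: rota_baxter_lie_algebra G by fact
  interpret H: rota_baxter_lie_algebra H by fact
  interpret GH: vector_space_pair "scl G" "scl H" by unfold_locales
  note br_simps = klinear_simps[OF H.br_linear_left] klinear_simps[OF H.br_linear_right]
    klinear_simps[OF H.rb_linear]
  have skew: "br H a b = - br H b a" for a b
  proof -
    have "br H (a + b) (a + b) = br H a a + br H b a + (br H a b + br H b b)"
      by (simp only: klinear_simps(1)[OF H.br_linear_left] klinear_simps(1)[OF H.br_linear_right])
    then have "br H a b + br H b a = br H (a + b) (a + b)"
      by (simp only: H.br_self[of a] H.br_self[of b] add_0_left add_0_right add.commute)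
    also have "\<dots> = 0" by (rule H.br_self)
    finally have "br H a b + br H b a = 0" .
    then show ?thesis by (simp only: eq_neg_iff_add_eq_0)
  qed
  have lin: "\<psi> x (a + b) = \<psi> x a + \<psi> x b" "\<psi> x (- a) = - \<psi> x a"
    if "(\<chi>, \<psi>, \<Phi>) \<in> nab_cocycles G H" for \<chi> \<psi> \<Phi> x a b
  proof -
    from that have "klinear H H (\<psi> x)" by (simp add: nab_cocycles_def derivation_def)
    then show "\<psi> x (a + b) = \<psi> x a + \<psi> x b" "\<psi> x (- a) = - \<psi> x a"
      by (rule klinear_simps)+
  qed
  have refl: "nab_equivalent G H c c" if c: "c \<in> nab_cocycles G H" for c
  proof -
    obtain \<chi> \<psi> \<Phi> where [simp]: "c = (\<chi>, \<psi>, \<Phi>)" by (cases c)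
    have "\<psi> x 0 = 0" for x
      using lin(1)[of \<chi> \<psi> \<Phi> x 0 0] c by simp
    then show ?thesis
      unfolding nab_equivalent_def
      by (auto simp: GH.linear_zero br_simps intro!: exI[of _ "\<lambda>_. 0"])
  qed
  have sym: "nab_equivalent G H c' c"
    if c: "c \<in> nab_cocycles G H" "c' \<in> nab_cocycles G H" and eq: "nab_equivalent G H c c'"
    for c c'
  proof -
    obtain \<chi> \<psi> \<Phi> where c1: "c = (\<chi>, \<psi>, \<Phi>)" by (cases c)
    obtain \<chi>' \<psi>' \<Phi>' where c2: "c' = (\<chi>', \<psi>', \<Phi>')" by (cases c')
    from eq obtain \<phi> where l: "klinear G H \<phi>"
      and 1: "\<And>x h. \<psi> x h = \<psi>' x h + br H (\<phi> x) h"
      and 2: "\<And>x y. \<chi> x y = \<chi>' x y +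
         (\<psi>' x (\<phi> y) - \<psi>' y (\<phi> x) - \<phi> (br G x y) + br H (\<phi> x) (\<phi> y))"
      and 3: "\<And>x. \<Phi> x = \<Phi>' x + (rb H (\<phi> x) - \<phi> (rb G x))"
      unfolding c1 c2 nab_equivalent_def by (auto simp: diff_eq_eq ac_simps)
    note linp = lin[OF c(2)[unfolded c2]]
    show ?thesis
      unfolding c1 c2 nab_equivalent_def prod.case
    proof (intro exI[of _ "\<lambda>x. - \<phi> x"] conjI allI)
      show "klinear G H (\<lambda>x. - \<phi> x)" using l by (rule GH.linear_compose_neg)
      fix x y h
      show "\<psi>' x h - \<psi> x h = br H (- \<phi> x) h" by (simp add: 1 br_simps)
      show "\<chi>' x y - \<chi> x y =
         \<psi> x (- \<phi> y) - \<psi> y (- \<phi> x) - - \<phi> (br G x y) + br H (- \<phi> x) (- \<phi> y)"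
        using skew[of "\<phi> y" "\<phi> x"] by (simp add: 1 2 linp br_simps algebra_simps)
      show "\<Phi>' x - \<Phi> x = rb H (- \<phi> x) - - \<phi> (rb G x)"
        by (simp add: 3 br_simps)
    qed
  qed
  have trans: "nab_equivalent G H c c''"
    if c: "c \<in> nab_cocycles G H" "c' \<in> nab_cocycles G H" "c'' \<in> nab_cocycles G H"
      and eq: "nab_equivalent G H c c'" "nab_equivalent G H c' c''"
    for c c' c''
  proof -
    obtain \<chi> \<psi> \<Phi> where c1: "c = (\<chi>, \<psi>, \<Phi>)" by (cases c)
    obtain \<chi>' \<psi>' \<Phi>' where c2: "c' = (\<chi>', \<psi>', \<Phi>')" by (cases c')
    obtain \<chi>'' \<psi>'' \<Phi>'' where c3: "c'' = (\<chi>'', \<psi>'', \<Phi>'')" by (cases c'')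
    from eq(1) obtain \<phi> where l: "klinear G H \<phi>"
      and 1: "\<And>x h. \<psi> x h = \<psi>' x h + br H (\<phi> x) h"
      and 2: "\<And>x y. \<chi> x y = \<chi>' x y +
         (\<psi>' x (\<phi> y) - \<psi>' y (\<phi> x) - \<phi> (br G x y) + br H (\<phi> x) (\<phi> y))"
      and 3: "\<And>x. \<Phi> x = \<Phi>' x + (rb H (\<phi> x) - \<phi> (rb G x))"
      unfolding c1 c2 nab_equivalent_def by (auto simp: diff_eq_eq ac_simps)
    from eq(2) obtain \<theta> where m: "klinear G H \<theta>"
      and 4: "\<And>x h. \<psi>' x h = \<psi>'' x h + br H (\<theta> x) h"
      and 5: "\<And>x y. \<chi>' x y = \<chi>'' x y +
         (\<psi>'' x (\<theta> y) - \<psi>'' y (\<theta> x) - \<theta> (br G x y) + br H (\<theta> x) (\<theta> y))"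
      and 6: "\<And>x. \<Phi>' x = \<Phi>'' x + (rb H (\<theta> x) - \<theta> (rb G x))"
      unfolding c2 c3 nab_equivalent_def by (auto simp: diff_eq_eq ac_simps)
    note linp = lin[OF c(3)[unfolded c3]]
    show ?thesis
      unfolding c1 c3 nab_equivalent_def prod.case
    proof (intro exI[of _ "\<lambda>x. \<phi> x + \<theta> x"] conjI allI)
      show "klinear G H (\<lambda>x. \<phi> x + \<theta> x)" using l m by (rule GH.linear_compose_add)
      fix x y h
      show "\<psi> x h - \<psi>'' x h = br H (\<phi> x + \<theta> x) h" by (simp add: 1 4 br_simps)
      show "\<chi> x y - \<chi>'' x y =
         \<psi>'' x (\<phi> y + \<theta> y) - \<psi>'' y (\<phi> x + \<theta> x) - (\<phi> (br G x y) + \<theta> (br G x y))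
         + br H (\<phi> x + \<theta> x) (\<phi> y + \<theta> y)"
        using skew[of "\<theta> y" "\<phi> x"] by (simp add: 2 4 5 linp br_simps algebra_simps)
      show "\<Phi> x - \<Phi>'' x = rb H (\<phi> x + \<theta> x) - (\<phi> (rb G x) + \<theta> (rb G x))"
        by (simp add: 3 6 br_simps)
    qed
  qed
  show ?thesis
    unfolding nab_rel_def
  proof (rule equivI)
    show "{(c, c'). c \<in> nab_cocycles G H \<and> c' \<in> nab_cocycles G H \<and> nab_equivalent G H c c'}
      \<subseteq> nab_cocycles G H \<times> nab_cocycles G H" by auto
  next
    show "refl_on (nab_cocycles G H)
      {(c, c'). c \<in> nab_cocycles G H \<and> c' \<in> nab_cocycles G H \<and> nab_equivalent G H c c'}"
      using refl by (auto simp: refl_on_def)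
  next
    show "sym {(c, c'). c \<in> nab_cocycles G H \<and> c' \<in> nab_cocycles G H \<and> nab_equivalent G H c c'}"
      using sym by (auto simp only: sym_def mem_Collect_eq prod.case)
  next
    show "trans {(c, c'). c \<in> nab_cocycles G H \<and> c' \<in> nab_cocycles G H \<and> nab_equivalent G H c c'}"
      unfolding trans_def mem_Collect_eq prod.case using trans by meson
  qed
qed

lemma nab_class_eq_iff:
  assumes "rota_baxter_lie_algebra G" "rota_baxter_lie_algebra H"
    and "c \<in> nab_cocycles G H" "c' \<in> nab_cocycles G H"
  shows "nab_class G H c = nab_class G H c' \<longleftrightarrow> nab_equivalent G H c c'"
  using eq_equiv_class_iff[OF nab_rel_equiv[OF assms(1,2)] assms(3,4)] assms(3,4)
  by (simp add: nab_class_def nab_rel_def)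

context rb_extension
begin

lemma inv_i [simp]: "inv_into UNIV i (i h) = h"
  using i_inj by simp

lemma rb_hom_apply:
  assumes "rb_hom L M f"
  shows "f (x + y) = f x + f y" "f (x - y) = f x - f y" "f 0 = 0"
    "f (scl L a x) = scl M a (f x)" "f (br L x y) = br M (f x) (f y)" "f (rb L x) = rb M (f x)"
proof -
  from assms have l: "klinear L M f" by (simp add: rb_hom_def)
  show "f (x + y) = f x + f y" "f (x - y) = f x - f y" "f 0 = 0"
    "f (scl L a x) = scl M a (f x)" by (rule klinear_simps[OF l])+
  show "f (br L x y) = br M (f x) (f y)" "f (rb L x) = rb M (f x)"
    using assms by (simp_all add: rb_hom_def fun_eq_iff)
qed

lemma restriction_hom:
  assumes \<gamma>: "\<gamma> \<in> rb_auts E" "\<gamma> ` range i \<subseteq> range i"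
  shows "i (inv_into UNIV i (\<gamma> (i h))) = \<gamma> (i h)"
    and "rb_hom H H (inv_into UNIV i \<circ> \<gamma> \<circ> i)" and "inj (inv_into UNIV i \<circ> \<gamma> \<circ> i)"
proof -
  let ?b = "inv_into UNIV i \<circ> \<gamma> \<circ> i"
  have g: "rb_hom E E \<gamma>" "bij \<gamma>" using \<gamma>(1) by (auto simp: rb_auts_def)
  show ib: "i (inv_into UNIV i (\<gamma> (i h))) = \<gamma> (i h)" for h
    using \<gamma>(2) by (auto intro!: f_inv_into_f)
  note a = rb_hom_apply[OF g(1)] rb_hom_apply[OF i_hom]
  have eqI: "x = y" if "i x = i y" for x y using that i_inj by (simp add: inj_eq)
  have ib': "i (?b h) = \<gamma> (i h)" for h by (simp only: comp_apply ib)
  have "klinear H H ?b"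
    unfolding Vector_Spaces.linear_iff
    by (intro conjI allI eqI H.vector_space_axioms) (simp_all only: ib' a)
  moreover have "?b (br H x y) = br H (?b x) (?b y)" for x y
    by (rule eqI) (simp only: ib' a)
  moreover have "rb H (?b x) = ?b (rb H x)" for x
    by (rule eqI) (simp only: ib' a)
  ultimately show "rb_hom H H ?b" by (auto simp: rb_hom_def)
  show "inj ?b"
  proof (rule injI)
    fix x y assume "?b x = ?b y"
    then have "i (inv_into UNIV i (\<gamma> (i x))) = i (inv_into UNIV i (\<gamma> (i y)))" by simp
    then show "x = y" using g(2) i_inj by (simp add: ib bij_is_inj inj_eq)
  qed
qed

lemma surj_restriction_iff:
  assumes \<gamma>: "\<gamma> \<in> rb_auts E" "\<gamma> ` range i \<subseteq> range i"
  shows "surj (inv_into UNIV i \<circ> \<gamma> \<circ> i) \<longleftrightarrow> \<gamma> ` range i = range i"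
proof
  assume surj: "surj (inv_into UNIV i \<circ> \<gamma> \<circ> i)"
  have "i h \<in> \<gamma> ` range i" for h
  proof -
    obtain h' where "h = (inv_into UNIV i \<circ> \<gamma> \<circ> i) h'" using surj by (rule surjE)
    then have "h = inv_into UNIV i (\<gamma> (i h'))" by simp
    then have "i h = \<gamma> (i h')" by (simp add: restriction_hom(1)[OF \<gamma>])
    then show ?thesis by blast
  qed
  with \<gamma>(2) show "\<gamma> ` range i = range i" by blast
next
  assume eq: "\<gamma> ` range i = range i"
  show "surj (inv_into UNIV i \<circ> \<gamma> \<circ> i)"
    unfolding surj_def
  proof
    fix h
    have "i h \<in> \<gamma> ` range i" unfolding eq by (rule rangeI)
    then obtain h' where "i h = \<gamma> (i h')" by blast
    then have "h = (inv_into UNIV i \<circ> \<gamma> \<circ> i) h'" by (simp flip: \<open>i h = \<gamma> (i h')\<close>)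
    then show "\<exists>x. h = (inv_into UNIV i \<circ> \<gamma> \<circ> i) x" ..
  qed
qed

lemma quotient_aut:
  assumes s: "is_section E G p s" and \<gamma>: "\<gamma> \<in> rb_auts E" "\<gamma> ` range i = range i"
  shows "p \<circ> \<gamma> \<circ> s \<in> rb_auts G"
proof -
  let ?a = "p \<circ> \<gamma> \<circ> s"
  have g: "rb_hom E E \<gamma>" "bij \<gamma>" using \<gamma>(1) by (auto simp: rb_auts_def)
  have ps: "p (s x) = x" for x
    using s by (metis comp_apply id_apply is_section_def)
  note a = rb_hom_apply[OF g(1)] rb_hom_apply[OF p_hom]
  have ker: "p (\<gamma> e) = 0 \<longleftrightarrow> p e = 0" for e
  proof -
    have "\<gamma> e \<in> \<gamma> ` range i \<longleftrightarrow> e \<in> range i" using g(2) by (simp add: bij_is_inj inj_image_mem_iff)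
    then show ?thesis using \<gamma>(2) exact by simp
  qed
  have eq: "p (\<gamma> (s (p e))) = p (\<gamma> e)" for e
    using ker[of "s (p e) - e"] by (simp add: a ps)
  have surjp: "\<exists>e. x = p e" for x using p_surj by (rule surjD)
  have "klinear G G ?a"
    unfolding Vector_Spaces.linear_iff
  proof (intro conjI allI G.vector_space_axioms)
    fix c x y
    obtain u v where [simp]: "x = p u" "y = p v" using surjp by meson
    show "?a (x + y) = ?a x + ?a y" using eq[of "u + v"] by (simp add: eq a)
    show "?a (scl G c x) = scl G c (?a x)" using eq[of "scl E c u"] by (simp add: eq a)
  qed
  moreover have "?a (br G x y) = br G (?a x) (?a y)" for x y
  proof -
    obtain u v where [simp]: "x = p u" "y = p v" using surjp by meson
    show ?thesis using eq[of "br E u v"] by (simp add: eq a)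
  qed
  moreover have "rb G (?a x) = ?a (rb G x)" for x
  proof -
    obtain u where [simp]: "x = p u" using surjp by meson
    show ?thesis using eq[of "rb E u"] by (simp add: eq a)
  qed
  moreover have "inj ?a"
  proof (rule injI)
    fix x y assume "?a x = ?a y"
    then have "p (\<gamma> (s x - s y)) = 0" by (simp add: a)
    then have "p (s x - s y) = 0" by (simp only: ker)
    then show "x = y" by (simp add: a ps)
  qed
  moreover have "surj ?a"
    unfolding surj_def
  proof
    fix x
    obtain u where u: "x = p u" using surjp by meson
    obtain v where "u = \<gamma> v" using g(2) by (meson bij_pointE)
    then have "x = ?a (p v)" by (simp add: u eq)
    then show "\<exists>y. x = ?a y" ..
  qed
  ultimately show ?thesis by (auto simp: rb_auts_def rb_hom_def bij_def)
qed

lemma Aut_h_iff_tau: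
  assumes s: "is_section E G p s" and \<gamma>: "\<gamma> \<in> rb_auts E" "\<gamma> ` range i \<subseteq> range i"
  shows "\<gamma> \<in> carrier (Aut_h E i) \<longleftrightarrow> tau i p s \<gamma> \<in> carrier (Aut H \<times>\<times> Aut G)"
proof -
  have 1: "inv_into UNIV i \<circ> \<gamma> \<circ> i \<in> rb_auts H \<longleftrightarrow> \<gamma> ` range i = range i"
    using restriction_hom(2,3)[OF \<gamma>] surj_restriction_iff[OF \<gamma>]
    unfolding rb_auts_def bij_def mem_Collect_eq by blast
  show ?thesis
    using \<gamma>(1) 1 quotient_aut[OF s \<gamma>(1)]
    unfolding Aut_h_def Aut_def comp_group_def tau_def carrier_DirProd by auto
qed

lemma Aut_h_iff_subset:
  assumes "finite_dimensional_vector_space (scl H) B" and \<gamma>: "\<gamma> \<in> rb_auts E"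
  shows "\<gamma> \<in> carrier (Aut_h E i) \<longleftrightarrow> \<gamma> ` range i \<subseteq> range i"
proof -
  interpret finite_dimensional_vector_space "scl H" B by fact
  have "\<gamma> ` range i = range i" if sub: "\<gamma> ` range i \<subseteq> range i"
  proof -
    note r = restriction_hom(2,3)[OF \<gamma> sub]
    from r(1) have "klinear H H (inv_into UNIV i \<circ> \<gamma> \<circ> i)" by (simp add: rb_hom_def)
    from linear_inj_imp_surj[OF this r(2)] show ?thesis
      using surj_restriction_iff[OF \<gamma> sub] by simp
  qed
  with \<gamma> show ?thesis by (auto simp: Aut_h_def comp_group_def)
qed

end

end

theory Submission
  imports Defs
begin

text \<open>
  Exactness at the first two groups is exactness of a kernel; the content is that the Wells map
  takes values in the cohomology set and that the sequence is exact at \<open>Aut H \<times> Aut G\<close>.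
  Call two extensions of \<open>G\<close> by \<open>H\<close> isomorphic if an isomorphism of their middle terms
  induces the identity on \<open>H\<close> and on \<open>G\<close>. Two observations reduce both to
  the classification of extensions by non-abelian cohomology.

  First, twisting the induced cocycle by \<open>(\<beta>, \<alpha>)\<close> has a meaning: keep \<open>E\<close>, but
  relabel \<open>H\<close> and \<open>G\<close>, so that the inclusion becomes \<open>i \<circ> \<beta>\<inverse>\<close> and the projection
  \<open>\<alpha> \<circ> p\<close>. This is again an extension, \<open>s \<circ> \<alpha>\<inverse>\<close> is a section of it, and the
  cocycle that this section induces is the twisted cocycle (\<open>twist_induced_cocycle\<close>). In
  particular the twist is a cocycle, because every induced cocycle is one
  (\<open>induced_cocycle_is_cocycle\<close>).

  Secondly, induced cocycles are equivalent iff the extensions are isomorphic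
  (\<open>nab_equivalent_induced_iff\<close>). A section identifies the middle term with
  \<open>H \<times> G\<close> as a vector space, the cocycle records the bracket and the operator in these
  coordinates, and a map \<open>\<phi>\<close> witnessing an equivalence is the same thing as a map
  \<open>(h, x) \<mapsto> (h + \<phi> x, x)\<close> compatible with both structures.

  Together: the Wells map vanishes at \<open>(\<beta>, \<alpha>)\<close> iff the relabelled extension is
  isomorphic to the original one, that is, iff some automorphism \<open>\<theta>\<close> of \<open>E\<close> satisfies
  \<open>\<theta> \<circ> i = i \<circ> \<beta>\<close> and \<open>p \<circ> \<theta> = \<alpha> \<circ> p\<close> (\<open>Wells_kernel_iff\<close>). These two equations
  say precisely that \<open>\<tau>(\<theta>) = (\<beta>, \<alpha>)\<close> (\<open>tau_eq_iff\<close>). As they compose, \<open>\<tau>\<close> is also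
  seen to be a homomorphism.
\<close>

section \<open>Brackets and morphisms\<close>

context lie_algebra
begin

lemmas br_simps = klinear_simps[OF br_linear_left] klinear_simps[OF br_linear_right]

lemma br_skew: "br L x y = - br L y x"
proof -
  have "br L (x + y) (x + y) = br L x x + br L y x + (br L x y + br L y y)"
    by (simp only: br_simps(1,6))
  then have "br L x y + br L y x = 0"
    by (simp add: br_self add.commute)
  then show ?thesis
    by (simp only: eq_neg_iff_add_eq_0)
qed

text \<open>
  Directed from left to right, this form of the Jacobi identity rewrites every iterated bracket
  into right-nested ones.
\<close>

lemma br_br_left: "br L (br L x y) z = br L x (br L y z) - br L y (br L x z)"
proof -
  have "br L y (br L z x) = - br L y (br L x z)"
    using br_skew[of z x] by (simp add: br_simps)
  then show ?thesis
    using jacobi[of x y z] br_skew[of "br L x y" z] by (simp add: algebra_simps)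
qed

end

lemma rb_hom_simps:
  assumes "rb_hom L M f"
  shows "f (x + y) = f x + f y" "f (x - y) = f x - f y" "f (- x) = - f x" "f 0 = 0"
    "f (scl L a x) = scl M a (f x)" "f (br L x y) = br M (f x) (f y)" "f (rb L x) = rb M (f x)"
proof -
  from assms have l: "klinear L M f" by (simp add: rb_hom_def)
  show "f (x + y) = f x + f y" "f (x - y) = f x - f y" "f (- x) = - f x" "f 0 = 0"
    "f (scl L a x) = scl M a (f x)"
    by (rule klinear_simps[OF l])+
  show "f (br L x y) = br M (f x) (f y)" "f (rb L x) = rb M (f x)"
    using assms by (simp_all add: rb_hom_def fun_eq_iff)
qed

lemma rb_homI:
  assumes "rota_baxter_lie_algebra L" "rota_baxter_lie_algebra M"
    and "\<And>x y. f (x + y) = f x + f y" "\<And>a x. f (scl L a x) = scl M a (f x)"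
    and "\<And>x y. f (br L x y) = br M (f x) (f y)" "\<And>x. f (rb L x) = rb M (f x)"
  shows "rb_hom L M f"
proof -
  interpret L: rota_baxter_lie_algebra L by fact
  interpret M: rota_baxter_lie_algebra M by fact
  show ?thesis
    using assms L.vector_space_axioms M.vector_space_axioms
    by (simp add: rb_hom_def Vector_Spaces.linear_iff fun_eq_iff)
qed

lemma rb_hom_comp:
  assumes "rb_hom L M f" "rb_hom M N g"
  shows "rb_hom L N (g \<circ> f)"
  using assms Vector_Spaces.linear_compose[of "scl L" "scl M" f "scl N" g]
  by (auto simp: rb_hom_def fun_eq_iff)

lemma rb_hom_inv:
  assumes L: "rota_baxter_lie_algebra L" and M: "rota_baxter_lie_algebra M"
    and f: "rb_hom L M f" "bij f"
  shows "rb_hom M L (inv_into UNIV f)"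
proof (rule rb_homI[OF M L])
  note inj = bij_is_inj[OF f(2)]
  have [simp]: "f (inv_into UNIV f y) = y" for y
    using f(2) by (simp add: bij_is_surj surj_f_inv_f)
  have [simp]: "inv_into UNIV f (f x) = x" for x
    using inj by simp
  note h = rb_hom_simps[OF f(1)]
  fix x y a
  show "inv_into UNIV f (x + y) = inv_into UNIV f x + inv_into UNIV f y"
    by (rule injD[OF inj]) (simp add: h)
  show "inv_into UNIV f (scl M a x) = scl L a (inv_into UNIV f x)"
    by (rule injD[OF inj]) (simp add: h)
  show "inv_into UNIV f (br M x y) = br L (inv_into UNIV f x) (inv_into UNIV f y)"
    by (rule injD[OF inj]) (simp add: h)
  show "inv_into UNIV f (rb M x) = rb L (inv_into UNIV f x)"
    by (rule injD[OF inj]) (simp add: h)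
qed

section \<open>Groups of automorphisms\<close>

lemma group_comp_group:
  assumes "id \<in> A" "\<And>f g. f \<in> A \<Longrightarrow> g \<in> A \<Longrightarrow> f \<circ> g \<in> A"
    and "\<And>f. f \<in> A \<Longrightarrow> bij f" "\<And>f. f \<in> A \<Longrightarrow> inv_into UNIV f \<in> A"
  shows "group (comp_group A)"
proof (rule groupI)
  fix f assume f: "f \<in> carrier (comp_group A)"
  then have "inv_into UNIV f \<in> A" "inv_into UNIV f \<circ> f = id"
    using assms(3,4) by (simp_all add: comp_group_def bij_is_inj)
  then show "\<exists>g\<in>carrier (comp_group A).
      g \<otimes>\<^bsub>comp_group A\<^esub> f = \<one>\<^bsub>comp_group A\<^esub>"
    by (auto simp: comp_group_def)
qed (use assms in \<open>auto simp: comp_group_def\<close>)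

context
  fixes L :: "('k::field_char_0, 'a::ab_group_add, 'x) rb_lie_scheme"
  assumes L: "rota_baxter_lie_algebra L"
begin

lemma rb_auts_id: "id \<in> rb_auts L"
  by (auto simp: rb_auts_def intro!: rb_homI[OF L L])

lemma rb_auts_comp: "f \<in> rb_auts L \<Longrightarrow> g \<in> rb_auts L \<Longrightarrow> f \<circ> g \<in> rb_auts L"
  by (auto simp: rb_auts_def bij_comp intro: rb_hom_comp)

lemma rb_auts_inv: "f \<in> rb_auts L \<Longrightarrow> inv_into UNIV f \<in> rb_auts L"
  by (simp add: rb_auts_def bij_imp_bij_inv rb_hom_inv[OF L L])

lemma group_Aut: "group (Aut L)"
  unfolding Aut_def
  by (intro group_comp_group rb_auts_id rb_auts_comp rb_auts_inv) (simp_all add: rb_auts_def)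

end

section \<open>Extensions with a section\<close>

locale sectioned_extension = rb_extension H E G i p
  for H :: "('k::field_char_0, 'h::ab_group_add) rb_lie"
    and E :: "('k, 'e::ab_group_add) rb_lie"
    and G :: "('k, 'g::ab_group_add) rb_lie"
    and i :: "'h \<Rightarrow> 'e" and p :: "'e \<Rightarrow> 'g" +
  fixes s :: "'g \<Rightarrow> 'e"
  assumes section_s: "is_section E G p s"
begin

definition "chi = (\<lambda>x y. inv_into UNIV i (br E (s x) (s y) - s (br G x y)))"
definition "psi = (\<lambda>x h. inv_into UNIV i (br E (s x) (i h)))"
definition "Phi = (\<lambda>x. inv_into UNIV i (rb E (s x) - s (rb G x)))"

lemma induced_cocycle_eq: "induced_cocycle E G i s = (chi, psi, Phi)"
  by (simp add: induced_cocycle_def chi_def psi_def Phi_def)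

lemmas i_simps = rb_hom_simps[OF i_hom]
lemmas p_simps = rb_hom_simps[OF p_hom]

lemma s_linear: "klinear G E s"
  using section_s by (simp add: is_section_def)

lemmas s_simps = klinear_simps[OF s_linear]

lemma p_s [simp]: "p (s x) = x"
  using section_s by (metis comp_apply id_apply is_section_def)

lemma p_i [simp]: "p (i h) = 0"
  using exact by blast

lemma i_inv: "p e = 0 \<Longrightarrow> i (inv_into UNIV i e) = e"
  using exact by (auto intro!: f_inv_into_f)

lemma i_eqD: "i a = i b \<Longrightarrow> a = b"
  using i_inj by (simp add: inj_eq)

lemma i_chi: "i (chi x y) = br E (s x) (s y) - s (br G x y)"
  unfolding chi_def by (rule i_inv) (simp add: p_simps)

lemma i_psi: "i (psi x h) = br E (s x) (i h)"
  unfolding psi_def by (rule i_inv) (simp add: p_simps G.br_simps)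

lemma i_Phi: "i (Phi x) = rb E (s x) - s (rb G x)"
  unfolding Phi_def by (rule i_inv) (simp add: p_simps)

text \<open>
  Through the injection \<open>i\<close>, the components of the cocycle become expressions in the bracket
  and the operator of \<open>E\<close>, so that identities in \<open>H\<close> can be checked in \<open>E\<close>.
\<close>

lemmas i_cocycle = i_chi i_psi i_Phi

lemma decompose: obtains h where "e = i h + s (p e)"
proof
  show "e = i (inv_into UNIV i (e - s (p e))) + s (p e)"
    by (subst i_inv) (simp_all add: p_simps)
qed

lemmas U_simps = klinear_simps[OF E.rb_linear]

lemma klinear_into_H:
  assumes "vector_space (scl V)"
    and "\<And>x y. i (f (x + y)) = i (f x) + i (f y)" "\<And>a x. i (f (scl V a x)) = scl E a (i (f x))"
  shows "klinear V H f"
  unfolding Vector_Spaces.linear_iff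
  using assms H.vector_space_axioms by (auto intro!: i_eqD simp: i_simps)

text \<open>
  Under \<open>i\<close>, the derivation property and the first two conditions follow from the Jacobi
  identity of \<open>E\<close>, and the last two from its Rota-Baxter identity. The values of \<open>s\<close> at
  brackets and at images of \<open>rb G\<close> cancel in pairs, with two exceptions: in the second condition the values at iterated
  brackets cancel by the Jacobi identity of \<open>G\<close>, and in the last one the value at
  \<open>br G (rb G x) (rb G y)\<close> cancels by the Rota-Baxter identity of \<open>G\<close>.
\<close>

lemma induced_cocycle_is_cocycle: "induced_cocycle E G i s \<in> nab_cocycles G H"
proof -
  note simps = i_simps i_cocycle s_simps E.br_simps G.br_simps U_simps
  note T_simps = klinear_simps[OF G.rb_linear]
  have "klinear G H (chi x)" "klinear G H (\<lambda>x. chi x y)" for x y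
    by (rule klinear_into_H[OF G.vector_space_axioms];
      simp add: simps algebra_simps E.scale_right_diff_distrib)+
  moreover have "chi x x = 0" for x
    by (rule i_eqD) (simp add: simps E.br_self G.br_self)
  moreover have "derivation H (psi x)" for x
    unfolding derivation_def
  proof (intro conjI allI)
    show "klinear H H (psi x)"
      by (rule klinear_into_H[OF H.vector_space_axioms]; simp add: simps)
    show "psi x (br H h k) = br H (psi x h) k + br H h (psi x k)" for h k
      by (rule i_eqD) (simp add: simps E.br_br_left)
  qed
  moreover have "klinear G H (\<lambda>x. psi x h)" for h
    by (rule klinear_into_H[OF G.vector_space_axioms]; simp add: simps)
  moreover have "klinear G H Phi"
    by (rule klinear_into_H[OF G.vector_space_axioms];
      simp add: simps T_simps algebra_simps E.scale_right_diff_distrib)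
  moreover have "psi x (psi y h) - psi y (psi x h) - psi (br G x y) h = br H (chi x y) h" for x y h
    by (rule i_eqD) (simp add: simps E.br_br_left)
  moreover have "psi x (chi y z) + psi y (chi z x) + psi z (chi x y)
      - chi (br G x y) z - chi (br G y z) x - chi (br G z x) y = 0" for x y z
  proof (rule i_eqD)
    have "br G (br G x y) z + br G (br G y z) x + br G (br G z x) y =
        - (br G x (br G y z) + br G y (br G z x) + br G z (br G x y))"
      using G.br_skew[of x "br G y z"] G.br_skew[of y "br G z x"] G.br_skew[of z "br G x y"]
      by (simp add: algebra_simps)
    also have "\<dots> = 0"
      by (simp only: G.jacobi minus_zero)
    finally have "s (br G (br G x y) z + br G (br G y z) x + br G (br G z x) y) = s 0"
      by (rule arg_cong)
    then have G: "s (br G (br G x y) z) + s (br G (br G y z) x) + s (br G (br G z x) y) = 0"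
      by (simp only: s_simps)
    show "i (psi x (chi y z) + psi y (chi z x) + psi z (chi x y)
      - chi (br G x y) z - chi (br G y z) x - chi (br G z x) y) = i 0"
      using G E.jacobi[of "s x" "s y" "s z"] E.br_skew[of "s x" "s (br G y z)"]
        E.br_skew[of "s y" "s (br G z x)"] E.br_skew[of "s z" "s (br G x y)"]
      by (simp add: simps algebra_simps)
  qed
  moreover have "psi (rb G x) (rb H h) =
       rb H (psi x (rb H h) + psi (rb G x) h) + rb H (br H (Phi x) h) - br H (Phi x) (rb H h)" for x h
    by (rule i_eqD) (simp add: simps E.rota_baxter algebra_simps)
  moreover have "chi (rb G x) (rb G y) - rb H (chi x (rb G y) + chi (rb G x) y)
       - Phi (br G x (rb G y) + br G (rb G x) y)
       + psi (rb G x) (Phi y) - psi (rb G y) (Phi x)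
       - rb H (psi x (Phi y) - psi y (Phi x)) + br H (Phi x) (Phi y) = 0" for x y
  proof (rule i_eqD)
    show "i (chi (rb G x) (rb G y) - rb H (chi x (rb G y) + chi (rb G x) y)
       - Phi (br G x (rb G y) + br G (rb G x) y)
       + psi (rb G x) (Phi y) - psi (rb G y) (Phi x)
       - rb H (psi x (Phi y) - psi y (Phi x)) + br H (Phi x) (Phi y)) = i 0"
      using E.br_skew[of "s y" "s (rb G x)"] E.br_skew[of "s (rb G y)" "rb E (s x)"]
        E.br_skew[of "s (rb G y)" "s (rb G x)"] E.br_skew[of "s y" "rb E (s x)"]
      by (simp add: simps T_simps G.rota_baxter E.rota_baxter algebra_simps)
  qed
  ultimately show ?thesis
    unfolding induced_cocycle_eq nab_cocycles_def by blast
qed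

end

section \<open>Equivalent cocycles and isomorphic extensions\<close>

text \<open>
  For an isomorphism \<open>\<theta>\<close>, the map \<open>\<theta> \<circ> s1\<close> is a second section of the second extension. It
  differs from \<open>s2\<close> by a map into the image of \<open>H\<close>, and this difference is the witness \<open>\<phi>\<close>.
  Conversely, \<open>\<phi>\<close> prescribes \<open>\<theta>\<close> on \<open>i1 k + s1 x\<close>, and the three equations of an
  equivalence are what \<open>\<theta>\<close> needs to respect brackets and operators.
\<close>

lemma nab_equivalent_induced_iff:
  assumes "sectioned_extension H E1 G i1 p1 s1" "sectioned_extension H E2 G i2 p2 s2"
  shows "nab_equivalent G H (induced_cocycle E1 G i1 s1) (induced_cocycle E2 G i2 s2) \<longleftrightarrow>
    (\<exists>\<theta>. rb_hom E1 E2 \<theta> \<and> bij \<theta> \<and> \<theta> \<circ> i1 = i2 \<and> p2 \<circ> \<theta> = p1)"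
    (is "?equiv \<longleftrightarrow> ?iso")
proof -
  interpret X1: sectioned_extension H E1 G i1 p1 s1 by fact
  interpret X2: sectioned_extension H E2 G i2 p2 s2 by fact
  note simps1 = X1.i_simps X1.i_cocycle X1.s_simps X1.E.br_simps X1.U_simps
  note simps2 = X2.i_simps X2.i_cocycle X2.s_simps X2.E.br_simps X2.U_simps
  show ?thesis
  proof
    assume ?iso
    then obtain \<theta> where \<theta>: "rb_hom E1 E2 \<theta>" and \<theta>_i: "\<And>h. \<theta> (i1 h) = i2 h"
      and p_\<theta>: "\<And>e. p2 (\<theta> e) = p1 e"
      by (auto simp: fun_eq_iff)
    note h = rb_hom_simps[OF \<theta>]
    define \<phi> where "\<phi> x = inv_into UNIV i2 (\<theta> (s1 x) - s2 x)" for x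
    have i_\<phi>: "i2 (\<phi> x) = \<theta> (s1 x) - s2 x" for x
      unfolding \<phi>_def by (rule X2.i_inv) (simp add: X2.p_simps p_\<theta>)
    have c: "i2 (X1.chi x y) = br E2 (\<theta> (s1 x)) (\<theta> (s1 y)) - \<theta> (s1 (br G x y))"
      "i2 (X1.psi x k) = br E2 (\<theta> (s1 x)) (i2 k)"
      "i2 (X1.Phi x) = rb E2 (\<theta> (s1 x)) - \<theta> (s1 (rb G x))" for x y k
      by (simp_all add: X1.i_cocycle h flip: \<theta>_i)
    show ?equiv
      unfolding X1.induced_cocycle_eq X2.induced_cocycle_eq nab_equivalent_def prod.case
    proof (intro exI[of _ \<phi>] conjI allI)
      show "klinear G H \<phi>"
        by (rule X2.klinear_into_H[OF X1.G.vector_space_axioms])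
          (simp_all add: i_\<phi> simps1 simps2 h X2.E.scale_right_diff_distrib)
      fix x y k
      show "X1.psi x k - X2.psi x k = br H (\<phi> x) k"
        by (rule X2.i_eqD) (simp add: c i_\<phi> simps2)
      show "X1.chi x y - X2.chi x y = X2.psi x (\<phi> y) - X2.psi y (\<phi> x) - \<phi> (br G x y)
          + br H (\<phi> x) (\<phi> y)"
        using X2.E.br_skew[of "s2 y" "\<theta> (s1 x)"] X2.E.br_skew[of "s2 y" "s2 x"]
        by (intro X2.i_eqD) (simp add: c i_\<phi> simps2 algebra_simps)
      show "X1.Phi x - X2.Phi x = rb H (\<phi> x) - \<phi> (rb G x)"
        by (rule X2.i_eqD) (simp add: c i_\<phi> simps2 algebra_simps)
    qed
  next
    assume ?equiv
    then obtain \<phi> where \<phi>: "klinear G H \<phi>"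
      and psi: "\<And>x k. X1.psi x k = X2.psi x k + br H (\<phi> x) k"
      and chi: "\<And>x y. X1.chi x y = X2.chi x y +
         (X2.psi x (\<phi> y) - X2.psi y (\<phi> x) - \<phi> (br G x y) + br H (\<phi> x) (\<phi> y))"
      and Phi: "\<And>x. X1.Phi x = X2.Phi x + (rb H (\<phi> x) - \<phi> (rb G x))"
      unfolding X1.induced_cocycle_eq X2.induced_cocycle_eq nab_equivalent_def
      by (auto simp: diff_eq_eq ac_simps)
    note phi_simps = klinear_simps[OF \<phi>]
    \<comment> \<open>This is the map \<open>i1 k + s1 x \<mapsto> i2 (k + \<phi> x) + s2 x\<close>: the coordinates of
      \<open>e\<close> are \<open>x = p1 e\<close> and the preimage \<open>k\<close> of \<open>e - s1 x\<close>.\<close>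
    define \<theta> where "\<theta> e = i2 (inv_into UNIV i1 (e - s1 (p1 e)) + \<phi> (p1 e)) + s2 (p1 e)" for e
    have \<theta>: "\<theta> (i1 k + s1 x) = i2 (k + \<phi> x) + s2 x" for k x
      by (simp add: \<theta>_def X1.p_simps)
    have \<theta>_eq: "\<theta> e = i2 (k + \<phi> x) + s2 x" if "e = i1 k + s1 x" for e k x
      using that \<theta> by simp
    have split1: "\<exists>k x. e = i1 k + s1 x" for e
      by (metis X1.decompose)
    have split2: "\<exists>k x. e = i2 k + s2 x" for e
      by (metis X2.decompose)
    have "rb_hom E1 E2 \<theta>"
    proof (rule rb_homI)
      fix d e a
      obtain k x where d: "d = i1 k + s1 x" using split1 by blast
      obtain l y where e: "e = i1 l + s1 y" using split1 by blast
      have "d + e = i1 (k + l) + s1 (x + y)"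
        by (simp add: d e simps1)
      from \<theta>_eq[OF this] show "\<theta> (d + e) = \<theta> d + \<theta> e"
        by (simp add: d e \<theta> simps2 phi_simps)
      have "scl E1 a d = i1 (scl H a k) + s1 (scl G a x)"
        by (simp add: d simps1 X1.E.scale_right_distrib)
      from \<theta>_eq[OF this] show "\<theta> (scl E1 a d) = scl E2 a (\<theta> d)"
        by (simp add: d \<theta> simps2 phi_simps X2.E.scale_right_distrib)
      have "br E1 d e = i1 (br H k l + X1.psi x l - X1.psi y k + X1.chi x y) + s1 (br G x y)"
        using X1.E.br_skew[of "i1 k" "s1 y"] by (simp add: d e simps1)
      from \<theta>_eq[OF this] show "\<theta> (br E1 d e) = br E2 (\<theta> d) (\<theta> e)"
        using X2.E.br_skew[of "i2 k" "s2 y"] X2.E.br_skew[of "i2 k" "i2 (\<phi> y)"]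
          X2.E.br_skew[of "i2 (\<phi> x)" "s2 y"]
        by (simp add: d e \<theta> psi chi simps2)
      have "rb E1 d = i1 (rb H k + X1.Phi x) + s1 (rb G x)"
        by (simp add: d simps1)
      from \<theta>_eq[OF this] show "\<theta> (rb E1 d) = rb E2 (\<theta> d)"
        by (simp add: d \<theta> Phi simps2)
    qed unfold_locales
    moreover have "\<theta> \<circ> i1 = i2"
      using \<theta>[where x = 0] by (simp add: fun_eq_iff simps1 simps2 phi_simps)
    moreover have p_\<theta>: "p2 \<circ> \<theta> = p1"
      by (simp add: fun_eq_iff \<theta>_def X2.p_simps)
    moreover have "bij \<theta>"
    proof (rule bijI)
      show "inj \<theta>"
      proof (rule injI)
        fix d e assume eq: "\<theta> d = \<theta> e"
        then have p: "p1 d = p1 e"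
          using p_\<theta> by (metis comp_apply)
        obtain k where d: "d = i1 k + s1 (p1 e)" using X1.decompose p by metis
        obtain l where e: "e = i1 l + s1 (p1 e)" using X1.decompose by metis
        have "i2 (k + \<phi> (p1 e)) = i2 (l + \<phi> (p1 e))"
          using eq \<theta>_eq[OF d] \<theta>_eq[OF e] by simp
        then have "k = l"
          using X2.i_eqD by force
        with d e show "d = e" by simp
      qed
      show "surj \<theta>"
        unfolding surj_def
      proof
        fix f
        obtain k x where "f = i2 k + s2 x" using split2 by blast
        then have "f = \<theta> (i1 (k - \<phi> x) + s1 x)"
          by (simp add: \<theta>)
        then show "\<exists>e. f = \<theta> e" ..
      qed
    qed
    ultimately show ?iso by blast
  qed
qed

section \<open>The Wells map\<close>

context sectioned_extension
begin

text \<open>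
  Relabelling \<open>H\<close> along \<open>\<beta>\<close> and \<open>G\<close> along \<open>\<alpha>\<close> realises the twist of the cocycle on
  the level of extensions.
\<close>

lemma
  assumes \<beta>: "\<beta> \<in> rb_auts H" and \<alpha>: "\<alpha> \<in> rb_auts G"
  shows twisted_extension:
      "sectioned_extension H E G (i \<circ> inv_into UNIV \<beta>) (\<alpha> \<circ> p) (s \<circ> inv_into UNIV \<alpha>)"
    and twist_induced_cocycle:
      "twist (\<beta>, \<alpha>) (induced_cocycle E G i s) =
        induced_cocycle E G (i \<circ> inv_into UNIV \<beta>) (s \<circ> inv_into UNIV \<alpha>)"
proof -
  have b: "rb_hom H H \<beta>" "bij \<beta>" and a: "rb_hom G G \<alpha>" "bij \<alpha>"
    using \<beta> \<alpha> by (auto simp: rb_auts_def)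
  note b' = rb_hom_inv[OF H.rota_baxter_lie_algebra_axioms H.rota_baxter_lie_algebra_axioms b]
  note a' = rb_hom_inv[OF G.rota_baxter_lie_algebra_axioms G.rota_baxter_lie_algebra_axioms a]
  have binv: "bij (inv_into UNIV \<beta>)"
    using b(2) by (rule bij_imp_bij_inv)
  have [simp]: "\<beta> (inv_into UNIV \<beta> h) = h" "inv_into UNIV \<beta> (\<beta> h) = h"
    "\<alpha> (inv_into UNIV \<alpha> x) = x" for h x
    using a(2) b(2) by (simp_all add: bij_is_surj surj_f_inv_f bij_is_inj)
  have \<alpha>_0: "\<alpha> x = 0 \<longleftrightarrow> x = 0" for x
    using a(2) rb_hom_simps(4)[OF a(1)] by (metis bij_is_inj injD)
  show "sectioned_extension H E G (i \<circ> inv_into UNIV \<beta>) (\<alpha> \<circ> p) (s \<circ> inv_into UNIV \<alpha>)"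
  proof unfold_locales
    show "rb_hom H E (i \<circ> inv_into UNIV \<beta>)" by (rule rb_hom_comp[OF b' i_hom])
    show "rb_hom E G (\<alpha> \<circ> p)" by (rule rb_hom_comp[OF p_hom a(1)])
    show "inj (i \<circ> inv_into UNIV \<beta>)" using i_inj binv by (simp add: inj_compose bij_is_inj)
    show "surj (\<alpha> \<circ> p)" using p_surj bij_is_surj[OF a(2)] by (rule comp_surj)
    show "range (i \<circ> inv_into UNIV \<beta>) = {e. (\<alpha> \<circ> p) e = 0}"
    proof -
      have "range (i \<circ> inv_into UNIV \<beta>) = i ` range (inv_into UNIV \<beta>)"
        by (rule image_comp[symmetric])
      then show ?thesis
        using bij_is_surj[OF binv] by (simp add: exact \<alpha>_0)
    qed
    have "klinear G G (inv_into UNIV \<alpha>)" using a' by (simp add: rb_hom_def)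
    from Vector_Spaces.linear_compose[OF this s_linear]
    show "is_section E G (\<alpha> \<circ> p) (s \<circ> inv_into UNIV \<alpha>)"
      by (simp add: is_section_def fun_eq_iff)
  qed
  then interpret X: sectioned_extension H E G "i \<circ> inv_into UNIV \<beta>" "\<alpha> \<circ> p" "s \<circ> inv_into UNIV \<alpha>" .
  note a'_simps = rb_hom_simps[OF a']
  have inv_eq: "inv_into UNIV (i \<circ> inv_into UNIV \<beta>) e = \<beta> h" if "e = i h" for e h
    using X.inv_i[of "\<beta> h"] that by simp
  show "twist (\<beta>, \<alpha>) (induced_cocycle E G i s) =
      induced_cocycle E G (i \<circ> inv_into UNIV \<beta>) (s \<circ> inv_into UNIV \<alpha>)"
    unfolding induced_cocycle_eq unfolding induced_cocycle_def twist_def prod.case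
    by (auto intro!: ext inv_eq[symmetric] simp: i_cocycle a'_simps)
qed

lemma Wells_kernel_iff:
  "(\<beta>, \<alpha>) \<in> Wells_kernel H E G i s \<longleftrightarrow> \<beta> \<in> rb_auts H \<and> \<alpha> \<in> rb_auts G \<and>
    (\<exists>\<theta> \<in> rb_auts E. \<theta> \<circ> i = i \<circ> \<beta> \<and> p \<circ> \<theta> = \<alpha> \<circ> p)"
proof -
  have "Wells H E G i s (\<beta>, \<alpha>) = Wells_zero H E G i s \<longleftrightarrow>
      (\<exists>\<theta> \<in> rb_auts E. \<theta> \<circ> i = i \<circ> \<beta> \<and> p \<circ> \<theta> = \<alpha> \<circ> p)"
    if \<beta>: "\<beta> \<in> rb_auts H" and \<alpha>: "\<alpha> \<in> rb_auts G"
  proof -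
    interpret X: sectioned_extension H E G "i \<circ> inv_into UNIV \<beta>" "\<alpha> \<circ> p" "s \<circ> inv_into UNIV \<alpha>"
      by (rule twisted_extension[OF \<beta> \<alpha>])
    have "bij \<beta>" using \<beta> by (simp add: rb_auts_def)
    then have "\<theta> \<circ> (i \<circ> inv_into UNIV \<beta>) = i \<longleftrightarrow> \<theta> \<circ> i = i \<circ> \<beta>" for \<theta>
      by (metis bij_is_inj bij_is_surj comp_assoc comp_id inv_o_cancel surj_iff)
    then show ?thesis
      unfolding Wells_def Wells_zero_def twist_induced_cocycle[OF \<beta> \<alpha>]
      using nab_class_eq_iff[OF G.rota_baxter_lie_algebra_axioms H.rota_baxter_lie_algebra_axioms
          X.induced_cocycle_is_cocycle induced_cocycle_is_cocycle]
        nab_equivalent_induced_iff[OF X.sectioned_extension_axioms sectioned_extension_axioms]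
      by (auto simp: rb_auts_def)
  qed
  then show ?thesis
    by (auto simp: Wells_kernel_def Aut_def comp_group_def)
qed

lemma carrier_Aut_h: "carrier (Aut_h E i) = {\<gamma> \<in> rb_auts E. \<gamma> ` range i = range i}"
  by (simp add: Aut_h_def comp_group_def)

text \<open>
  This form of \<open>\<tau>\<close> mentions neither the section nor \<open>inv_into\<close>, and its equations can be
  composed.
\<close>

lemma tau_eq_iff:
  assumes "\<gamma> \<in> carrier (Aut_h E i)"
  shows "tau i p s \<gamma> = (\<beta>, \<alpha>) \<longleftrightarrow> \<gamma> \<circ> i = i \<circ> \<beta> \<and> p \<circ> \<gamma> = \<alpha> \<circ> p"
proof -
  have \<gamma>: "\<gamma> \<in> rb_auts E" "\<gamma> ` range i \<subseteq> range i"
    using assms by (auto simp: carrier_Aut_h)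
  then have h: "rb_hom E E \<gamma>" by (simp add: rb_auts_def)
  note r = restriction_hom(1)[OF \<gamma>]
  have p_\<gamma>_i: "p (\<gamma> (i h)) = 0" for h
    by (subst r[symmetric]) (rule p_i)
  have "p (\<gamma> (s (p e))) = p (\<gamma> e)" for e
  proof -
    have "i (inv_into UNIV i (e - s (p e))) = e - s (p e)"
      by (rule i_inv) (simp add: p_simps)
    then have "p (\<gamma> (e - s (p e))) = 0"
      by (metis p_\<gamma>_i)
    then show ?thesis
      by (simp add: rb_hom_simps[OF h] p_simps)
  qed
  then have "p \<circ> \<gamma> \<circ> s = \<alpha> \<longleftrightarrow> p \<circ> \<gamma> = \<alpha> \<circ> p"
    by (metis comp_apply ext p_s)
  moreover have "inv_into UNIV i (\<gamma> (i h)) = \<beta> h \<longleftrightarrow> \<gamma> (i h) = i (\<beta> h)" for h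
    by (metis r inv_i)
  then have "inv_into UNIV i \<circ> \<gamma> \<circ> i = \<beta> \<longleftrightarrow> \<gamma> \<circ> i = i \<circ> \<beta>"
    by (simp add: fun_eq_iff)
  ultimately show ?thesis
    by (simp add: tau_def)
qed

lemma group_Aut_h: "group (Aut_h E i)"
  unfolding Aut_h_def
proof (rule group_comp_group)
  note E = E.rota_baxter_lie_algebra_axioms
  let ?A = "{\<gamma> \<in> rb_auts E. \<gamma> ` range i = range i}"
  show "id \<in> ?A"
    using rb_auts_id[OF E] by simp
  show "bij f" if "f \<in> ?A" for f
    using that by (simp add: rb_auts_def)
  show "f \<circ> g \<in> ?A" if "f \<in> ?A" "g \<in> ?A" for f g
  proof -
    have "(f \<circ> g) ` range i = f ` g ` range i"
      by (rule image_comp[symmetric])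
    also have "\<dots> = range i"
      using that by (simp only: mem_Collect_eq)
    finally show ?thesis
      using that rb_auts_comp[OF E] by blast
  qed
  show "inv_into UNIV f \<in> ?A" if f: "f \<in> ?A" for f
  proof -
    from f have "inv_into UNIV f ` range i = inv_into UNIV f ` f ` range i" by simp
    also have "\<dots> = range i"
      using f by (intro image_inv_f_f bij_is_inj) (simp add: rb_auts_def)
    finally show ?thesis
      using f rb_auts_inv[OF E] by blast
  qed
qed

lemma group_hom_tau: "group_hom (Aut_h E i) (Aut H \<times>\<times> Aut G) (tau i p s)"
proof (intro group_hom.intro group_hom_axioms.intro homI)
  show "group (Aut_h E i)" by (rule group_Aut_h)
  show "group (Aut H \<times>\<times> Aut G)"
    by (intro DirProd_group group_Aut H.rota_baxter_lie_algebra_axioms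
        G.rota_baxter_lie_algebra_axioms)
  show "tau i p s \<gamma> \<in> carrier (Aut H \<times>\<times> Aut G)" if "\<gamma> \<in> carrier (Aut_h E i)" for \<gamma>
    using that Aut_h_iff_tau[OF section_s, of \<gamma>] by (simp add: carrier_Aut_h)
  fix f g assume fg: "f \<in> carrier (Aut_h E i)" "g \<in> carrier (Aut_h E i)"
  then have fg': "f \<circ> g \<in> carrier (Aut_h E i)"
    using group.is_monoid[OF group_Aut_h, THEN monoid.m_closed]
    by (fastforce simp: Aut_h_def comp_group_def)
  obtain \<beta> \<alpha> where f: "tau i p s f = (\<beta>, \<alpha>)" by (cases "tau i p s f")
  obtain \<beta>' \<alpha>' where g: "tau i p s g = (\<beta>', \<alpha>')" by (cases "tau i p s g")
  have "(f \<circ> g) \<circ> i = i \<circ> (\<beta> \<circ> \<beta>')" "p \<circ> (f \<circ> g) = (\<alpha> \<circ> \<alpha>') \<circ> p"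
    using f g unfolding tau_eq_iff[OF fg(1)] tau_eq_iff[OF fg(2)] by (metis comp_assoc)+
  then have "tau i p s (f \<circ> g) = (\<beta> \<circ> \<beta>', \<alpha> \<circ> \<alpha>')"
    unfolding tau_eq_iff[OF fg'] by blast
  then show "tau i p s (f \<otimes>\<^bsub>Aut_h E i\<^esub> g) =
      tau i p s f \<otimes>\<^bsub>Aut H \<times>\<times> Aut G\<^esub> tau i p s g"
    by (simp add: f g Aut_h_def Aut_def comp_group_def DirProd_def)
qed

lemma carrier_Aut_hg:
  "carrier (Aut_hg E i p s) = kernel (Aut_h E i) (Aut H \<times>\<times> Aut G) (tau i p s)"
  by (simp add: Aut_hg_def kernel_def comp_group_def Aut_def DirProd_def)

lemma group_hom_inclusion: "group_hom (Aut_hg E i p s) (Aut_h E i) (\<lambda>\<gamma>. \<gamma>)"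
proof -
  let ?K = "kernel (Aut_h E i) (Aut H \<times>\<times> Aut G) (tau i p s)"
  interpret T: group_hom "Aut_h E i" "Aut H \<times>\<times> Aut G" "tau i p s" by (rule group_hom_tau)
  have "Aut_hg E i p s = (Aut_h E i)\<lparr>carrier := ?K\<rparr>"
    using carrier_Aut_hg by (simp add: Aut_hg_def Aut_h_def comp_group_def)
  moreover have "group_hom ((Aut_h E i)\<lparr>carrier := ?K\<rparr>) (Aut_h E i) (\<lambda>\<gamma>. \<gamma>)"
    by (intro group_hom.intro group_hom_axioms.intro homI T.G.group_axioms
        subgroup.subgroup_is_group[OF T.subgroup_kernel T.G.group_axioms])
      (auto simp: kernel_def)
  ultimately show ?thesis by simp
qed

lemma Wells_in_H2: "Wells H E G i s \<in> carrier (Aut H \<times>\<times> Aut G) \<rightarrow> H2_nab G H"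
proof
  fix ba assume "ba \<in> carrier (Aut H \<times>\<times> Aut G)"
  then obtain \<beta> \<alpha> where ba: "ba = (\<beta>, \<alpha>)" "\<beta> \<in> rb_auts H" "\<alpha> \<in> rb_auts G"
    by (auto simp: Aut_def comp_group_def)
  interpret X: sectioned_extension H E G "i \<circ> inv_into UNIV \<beta>" "\<alpha> \<circ> p" "s \<circ> inv_into UNIV \<alpha>"
    by (rule twisted_extension[OF ba(2,3)])
  show "Wells H E G i s ba \<in> H2_nab G H"
    unfolding Wells_def H2_nab_def nab_class_def ba(1) twist_induced_cocycle[OF ba(2,3)]
    by (intro quotientI X.induced_cocycle_is_cocycle)
qed

lemma image_tau: "tau i p s ` carrier (Aut_h E i) = Wells_kernel H E G i s"
proof (intro equalityI subsetI)
  fix ba assume "ba \<in> tau i p s ` carrier (Aut_h E i)"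
  then obtain \<gamma> where \<gamma>: "\<gamma> \<in> carrier (Aut_h E i)" "ba = tau i p s \<gamma>" by blast
  obtain \<beta> \<alpha> where ba: "ba = (\<beta>, \<alpha>)" by (cases ba)
  have "\<beta> \<in> rb_auts H" "\<alpha> \<in> rb_auts G"
    using group_hom.hom_closed[OF group_hom_tau \<gamma>(1)]
    by (auto simp: ba Aut_def comp_group_def simp flip: \<gamma>(2))
  moreover have "\<gamma> \<circ> i = i \<circ> \<beta>" "p \<circ> \<gamma> = \<alpha> \<circ> p"
    using \<gamma>(2) tau_eq_iff[OF \<gamma>(1)] ba by metis+
  ultimately show "ba \<in> Wells_kernel H E G i s"
    using \<gamma>(1) by (auto simp: ba Wells_kernel_iff carrier_Aut_h)
next
  fix ba assume ba: "ba \<in> Wells_kernel H E G i s"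
  obtain \<beta> \<alpha> where [simp]: "ba = (\<beta>, \<alpha>)" by (cases ba)
  from ba obtain \<theta> where \<theta>: "\<theta> \<in> rb_auts E" "\<theta> \<circ> i = i \<circ> \<beta>" "p \<circ> \<theta> = \<alpha> \<circ> p"
    and "bij \<beta>"
    by (auto simp: Wells_kernel_iff rb_auts_def)
  have "\<theta> ` range i = range (i \<circ> \<beta>)"
    using \<theta>(2) by (metis image_comp)
  also have "\<dots> = range i"
    using \<open>bij \<beta>\<close> by (metis bij_is_surj image_comp)
  finally have "\<theta> \<in> carrier (Aut_h E i)"
    using \<theta>(1) by (simp add: carrier_Aut_h)
  moreover from this have "tau i p s \<theta> = ba"
    using \<theta>(2,3) by (simp add: tau_eq_iff)
  ultimately show "ba \<in> tau i p s ` carrier (Aut_h E i)" by blast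
qed

end

theorem theorem5p3:
  fixes H :: "('k::field_char_0, 'h::ab_group_add) rb_lie"
    and E :: "('k, 'e::ab_group_add) rb_lie"
    and G :: "('k, 'g::ab_group_add) rb_lie"
    and i :: "'h \<Rightarrow> 'e" and p :: "'e \<Rightarrow> 'g" and s :: "'g \<Rightarrow> 'e"
  assumes "rb_extension H E G i p"
    and "is_section E G p s"
  shows "group_hom (Aut_hg E i p s) (Aut_h E i) (\<lambda>\<gamma>. \<gamma>)
    \<and> inj_on (\<lambda>\<gamma>. \<gamma>) (carrier (Aut_hg E i p s))
    \<and> group_hom (Aut_h E i) (Aut H \<times>\<times> Aut G) (tau i p s)
    \<and> (\<lambda>\<gamma>. \<gamma>) ` carrier (Aut_hg E i p s) = kernel (Aut_h E i) (Aut H \<times>\<times> Aut G) (tau i p s)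
    \<and> Wells H E G i s \<in> carrier (Aut H \<times>\<times> Aut G) \<rightarrow> H2_nab G H
    \<and> tau i p s ` carrier (Aut_h E i) = Wells_kernel H E G i s"
proof -
  interpret sectioned_extension H E G i p s
    using assms by (simp add: sectioned_extension_def sectioned_extension_axioms_def)
  show ?thesis
    using group_hom_inclusion group_hom_tau carrier_Aut_hg Wells_in_H2 image_tau by simp
qed

end
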